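(* Let $X$ be a finite connected ray-graph and let $n \ge 1$ be an integer. Then the hyperspace $C_n(X)$, equipped with the Vietoris topology, is path-connected.
   Context: A finite ray-graph is a space consisting of finitely many vertices (points), finitely many edges (each homeomorphic to $[0,1]$, attached at its endpoints to two vertices, or to one vertex twice) and finitely many rays (each homeomorphic to $[0,\infty)$, attached at its endpoint $0$ to one vertex). Edges and rays meet each other only at vertices. All ray-graphs considered are finite and connected. $X$ carries the topology of the arc-length metric (distance = length of a shortest path), where every edge has length one and every ray is isometrically parametrized by $[0,\infty)$. For $n\ge 1$, $C_n(X) = \{A \subset X : A \text{ is closed},\ A \neq \emptyset,\ A \text{ has at most } n \text{ connected components}\}$. Elements of $C_n(X)$ need not be bounded. The Vietoris topology on $C_n(X)$ is the topology with basis consisting of the sets $$\langle U_1,\dots,U_m\rangle = \Big\{A \in C_n(X) : A \subset \bigcup_{i=1}^m U_i \text{ and } A \cap U_i \neq \emptyset \text{ for all } i=1,\dots,m\Big\},$$ where $U_1,\dots,U_m$ is any finite collection of open subsets of $X$. Equivalently, it is generated by the sets $U^+ = \{A : A \subset U\}$ and $V^- = \{A : A \cap V \neq \emptyset\}$ for $U,V$ open in $X$. *)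

theory Defs
  imports "HOL-Analysis.Analysis"
begin

section \<open>Finite ray-graphs\<close>

text \<open>
  A finite ray-graph is given by its set \<open>V\<close> of vertices, finitely many parametrized edges
  \<open>edge e :: [0,1] \<rightarrow> X\<close> and finitely many parametrized rays \<open>ray r :: [0,\<infinity>) \<rightarrow> X\<close>. Values of the
  parametrizations outside \<open>[0,1]\<close> and \<open>[0,\<infinity>)\<close> are irrelevant. The index sets \<open>E\<close> and \<open>R\<close> leave
  room for multiple edges, and \<open>edge e 0 = edge e 1\<close> is allowed (loops).
\<close>

locale finite_ray_graph =
  fixes V :: "'a set"
    and E :: "'e set" and edge :: "'e \<Rightarrow> real \<Rightarrow> 'a"
    and R :: "'r set" and ray :: "'r \<Rightarrow> real \<Rightarrow> 'a"
  assumes finite_V: "finite V" and finite_E: "finite E" and finite_R: "finite R"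
    and edge_ends: "\<And>e. e \<in> E \<Longrightarrow> edge e 0 \<in> V \<and> edge e 1 \<in> V"
    and ray_end: "\<And>r. r \<in> R \<Longrightarrow> ray r 0 \<in> V"
    and edge_not_vertex: "\<And>e t. \<lbrakk>e \<in> E; 0 < t; t < 1\<rbrakk> \<Longrightarrow> edge e t \<notin> V"
    and ray_not_vertex: "\<And>r t. \<lbrakk>r \<in> R; 0 < t\<rbrakk> \<Longrightarrow> ray r t \<notin> V"
    and edge_eq_edge: "\<And>e e' s t. \<lbrakk>e \<in> E; e' \<in> E; 0 < s; s < 1; 0 < t; t < 1; edge e s = edge e' t\<rbrakk>
                         \<Longrightarrow> e = e' \<and> s = t"
    and ray_eq_ray: "\<And>r r' s t. \<lbrakk>r \<in> R; r' \<in> R; 0 < s; 0 < t; ray r s = ray r' t\<rbrakk>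
                         \<Longrightarrow> r = r' \<and> s = t"
    and edge_neq_ray: "\<And>e r s t. \<lbrakk>e \<in> E; r \<in> R; 0 < s; s < 1; 0 < t\<rbrakk> \<Longrightarrow> edge e s \<noteq> ray r t"
begin

definition points :: "'a set" where
  "points = V \<union> (\<Union>e\<in>E. edge e ` {0..1}) \<union> (\<Union>r\<in>R. ray r ` {0..})"

text \<open>
  \<open>path_of_length x y L\<close>: a concatenation of finitely many segments, each contained in a single
  edge or a single ray, leads from \<open>x\<close> to \<open>y\<close> and has total length \<open>L\<close>.
\<close>

inductive path_of_length :: "'a \<Rightarrow> 'a \<Rightarrow> real \<Rightarrow> bool" where
  path_refl: "x \<in> points \<Longrightarrow> path_of_length x x 0"
| path_edge: "\<lbrakk>path_of_length x (edge e s) L; e \<in> E; 0 \<le> s; s \<le> 1; 0 \<le> t; t \<le> 1\<rbrakk>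
                \<Longrightarrow> path_of_length x (edge e t) (L + \<bar>s - t\<bar>)"
| path_ray: "\<lbrakk>path_of_length x (ray r s) L; r \<in> R; 0 \<le> s; 0 \<le> t\<rbrakk>
                \<Longrightarrow> path_of_length x (ray r t) (L + \<bar>s - t\<bar>)"

text \<open>
  The arc-length distance, set to 0 off the graph as \<^locale>\<open>Metric_space\<close> wants a total function.
\<close>

definition arc_dist :: "'a \<Rightarrow> 'a \<Rightarrow> real" where
  "arc_dist x y = (if x \<in> points \<and> y \<in> points then Inf {L. path_of_length x y L} else 0)"

definition ray_graph_topology :: "'a topology" where
  "ray_graph_topology = Metric_space.mtopology points arc_dist"

end

text \<open>
  Connectedness is stated as the existence of paths between any two points; this is also what makes
  the arc-length distance finite.
\<close>

locale finite_connected_ray_graph = finite_ray_graph +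
  assumes path_exists: "\<And>x y. \<lbrakk>x \<in> points; y \<in> points\<rbrakk> \<Longrightarrow> \<exists>L. path_of_length x y L"


section \<open>The hyperspace of closed sets with at most \<open>n\<close> components\<close>

definition hyperspace_C :: "'a topology \<Rightarrow> nat \<Rightarrow> 'a set set" where
  "hyperspace_C X n = {A. closedin X A \<and> A \<noteq> {} \<and>
     finite (connected_components_of (subtopology X A)) \<and>
     card (connected_components_of (subtopology X A)) \<le> n}"

definition vietoris_basic :: "'a topology \<Rightarrow> nat \<Rightarrow> 'a set set \<Rightarrow> 'a set set" where
  "vietoris_basic X n \<U> = {A \<in> hyperspace_C X n. A \<subseteq> \<Union>\<U> \<and> (\<forall>U\<in>\<U>. A \<inter> U \<noteq> {})}"

definition is_vietoris_basic :: "'a topology \<Rightarrow> nat \<Rightarrow> 'a set set \<Rightarrow> bool" where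
  "is_vietoris_basic X n \<W> \<longleftrightarrow>
     (\<exists>\<U>. finite \<U> \<and> (\<forall>U\<in>\<U>. openin X U) \<and> \<W> = vietoris_basic X n \<U>)"

definition vietoris_topology :: "'a topology \<Rightarrow> nat \<Rightarrow> 'a set topology" where
  "vietoris_topology X n = topology (arbitrary union_of is_vietoris_basic X n)"


section \<open>The definitions above do yield a metric and a topology\<close>

lemma is_vietoris_basic_Int:
  assumes "is_vietoris_basic X n S" "is_vietoris_basic X n T"
  shows "is_vietoris_basic X n (S \<inter> T)"
proof -
  obtain A where A: "finite A" "\<forall>U\<in>A. openin X U" "S = vietoris_basic X n A"
    using assms(1) by (auto simp: is_vietoris_basic_def)
  obtain B where B: "finite B" "\<forall>U\<in>B. openin X U" "T = vietoris_basic X n B"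
    using assms(2) by (auto simp: is_vietoris_basic_def)
  define C where "C = (\<lambda>U. U \<inter> \<Union>B) ` A \<union> (\<lambda>U. U \<inter> \<Union>A) ` B"
  have C: "finite C" "\<forall>U\<in>C. openin X U"
    using A B by (auto simp: C_def)
  have "S \<inter> T = vietoris_basic X n C"
    unfolding A(3) B(3)
  proof (intro equalityI subsetI)
    fix K assume "K \<in> vietoris_basic X n A \<inter> vietoris_basic X n B"
    then have K: "K \<in> hyperspace_C X n" "K \<subseteq> \<Union>A" "K \<subseteq> \<Union>B"
      "\<forall>U\<in>A. K \<inter> U \<noteq> {}" "\<forall>U\<in>B. K \<inter> U \<noteq> {}"
      by (auto simp: vietoris_basic_def)
    have "K \<subseteq> \<Union>C"
    proof
      fix k assume "k \<in> K"
      then obtain U W where "U \<in> A" "k \<in> U" "W \<in> B" "k \<in> W" using K(2,3) by blast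
      then show "k \<in> \<Union>C" unfolding C_def by blast
    qed
    moreover have "\<forall>U\<in>C. K \<inter> U \<noteq> {}"
    proof -
      have "K \<inter> (U \<inter> \<Union>B) = K \<inter> U" "K \<inter> (U \<inter> \<Union>A) = K \<inter> U" for U
        using K(2,3) by auto
      then show ?thesis using K(4,5) by (auto simp: C_def simp del: Int_Union)
    qed
    ultimately show "K \<in> vietoris_basic X n C"
      using K(1) by (simp add: vietoris_basic_def)
  next
    fix K assume "K \<in> vietoris_basic X n C"
    then have K: "K \<in> hyperspace_C X n" "K \<subseteq> \<Union>C" "\<forall>U\<in>C. K \<inter> U \<noteq> {}"
      by (auto simp: vietoris_basic_def)
    have "K \<subseteq> \<Union>A" "K \<subseteq> \<Union>B" using K(2) by (auto simp: C_def)
    moreover have "\<forall>U\<in>A. K \<inter> U \<noteq> {}" "\<forall>U\<in>B. K \<inter> U \<noteq> {}"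
      using K(3) unfolding C_def ball_Un ball_simps(9) by blast+
    ultimately show "K \<in> vietoris_basic X n A \<inter> vietoris_basic X n B"
      using K(1) by (simp add: vietoris_basic_def)
  qed
  with C show ?thesis by (auto simp: is_vietoris_basic_def)
qed

lemma openin_vietoris_topology:
  "openin (vietoris_topology X n) = arbitrary union_of is_vietoris_basic X n"
  unfolding vietoris_topology_def
  by (intro topology_inverse' istopology_base is_vietoris_basic_Int)

lemma topspace_vietoris_topology: "topspace (vietoris_topology X n) = hyperspace_C X n"
proof (rule equalityI)
  have "openin (vietoris_topology X n) (topspace (vietoris_topology X n))" by simp
  then show "topspace (vietoris_topology X n) \<subseteq> hyperspace_C X n"
    unfolding openin_vietoris_topology
    by (fastforce simp: union_of_def is_vietoris_basic_def vietoris_basic_def)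
  have "hyperspace_C X n = vietoris_basic X n {topspace X}"
    by (auto simp: vietoris_basic_def hyperspace_C_def dest: closedin_subset)
  then have "is_vietoris_basic X n (hyperspace_C X n)"
    unfolding is_vietoris_basic_def by (intro exI[of _ "{topspace X}"]) auto
  then have "openin (vietoris_topology X n) (hyperspace_C X n)"
    by (simp add: openin_vietoris_topology arbitrary_union_of_inc)
  then show "hyperspace_C X n \<subseteq> topspace (vietoris_topology X n)"
    by (rule openin_subset)
qed

context finite_ray_graph
begin

lemma edge_in_points: "\<lbrakk>e \<in> E; 0 \<le> t; t \<le> 1\<rbrakk> \<Longrightarrow> edge e t \<in> points"
  using imageI[of t "{0..1}" "edge e"] unfolding points_def by (meson UN_I UnCI atLeastAtMost_iff)

lemma ray_in_points: "\<lbrakk>r \<in> R; 0 \<le> t\<rbrakk> \<Longrightarrow> ray r t \<in> points"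
  using imageI[of t "{0..}" "ray r"] unfolding points_def by (meson UN_I UnCI atLeast_iff)

lemma path_in_points: "path_of_length x y L \<Longrightarrow> x \<in> points \<and> y \<in> points"
  by (induction rule: path_of_length.induct) (auto intro: edge_in_points ray_in_points)

lemma path_nonneg: "path_of_length x y L \<Longrightarrow> 0 \<le> L"
  by (induction rule: path_of_length.induct) auto

lemma path_trans:
  assumes "path_of_length y z L'" "path_of_length x y L"
  shows "path_of_length x z (L + L')"
  using assms
proof (induction rule: path_of_length.induct)
  case (path_edge y e s L' t)
  then show ?case
    using path_of_length.path_edge[of x e s "L + L'" t] by (simp add: add.assoc)
next
  case (path_ray y r s L' t)
  then show ?case
    using path_of_length.path_ray[of x r s "L + L'" t] by (simp add: add.assoc)
qed auto

lemma path_sym: "path_of_length x y L \<Longrightarrow> path_of_length y x L"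
proof (induction rule: path_of_length.induct)
  case (path_edge x e s L t)
  have "path_of_length (edge e t) (edge e s) (0 + \<bar>t - s\<bar>)"
    by (intro path_of_length.path_edge path_refl edge_in_points path_edge.hyps)
  from path_trans[OF path_edge.IH this] show ?case
    by (simp add: abs_minus_commute add.commute)
next
  case (path_ray x r s L t)
  have "path_of_length (ray r t) (ray r s) (0 + \<bar>t - s\<bar>)"
    by (intro path_of_length.path_ray path_refl ray_in_points path_ray.hyps)
  from path_trans[OF path_ray.IH this] show ?case
    by (simp add: abs_minus_commute add.commute)
qed (auto intro: path_refl)

lemma points_cases:
  assumes "x \<in> points"
  obtains (vertex) "x \<in> V"
  | (edge) e t where "e \<in> E" "0 < t" "t < 1" "x = edge e t"
  | (ray) r t where "r \<in> R" "0 < t" "x = ray r t"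
proof -
  consider "x \<in> V" | e t where "e \<in> E" "0 \<le> t" "t \<le> 1" "x = edge e t"
    | r t where "r \<in> R" "0 \<le> t" "x = ray r t"
    using assms by (auto simp: points_def)
  then show thesis
  proof cases
    case 2
    then show thesis
      using that(1,2) edge_ends by (cases "t = 0 \<or> t = 1") (auto simp: less_le)
  next
    case 3
    then show thesis
      using that(1,3) ray_end by (cases "t = 0") (auto simp: less_le)
  qed (rule that(1))
qed

lemma edge_eq_interiorD:
  assumes "e \<in> E" "e' \<in> E" "0 \<le> s" "s \<le> 1" "0 < t" "t < 1" "edge e s = edge e' t"
  shows "e = e' \<and> s = t"
  using assms edge_eq_edge[of e e' s t] edge_not_vertex[of e' t] edge_ends[of e]
  by (metis less_le)

lemma ray_eq_interiorD:
  assumes "r \<in> R" "r' \<in> R" "0 \<le> s" "0 < t" "ray r s = ray r' t"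
  shows "r = r' \<and> s = t"
  using assms ray_eq_ray[of r r' s t] ray_not_vertex[of r' t] ray_end[of r]
  by (metis less_le)

lemma edge_neq_interior_ray:
  assumes "e \<in> E" "r \<in> R" "0 \<le> s" "s \<le> 1" "0 < t"
  shows "edge e s \<noteq> ray r t"
  using assms edge_neq_ray[of e r s t] ray_not_vertex[of r t] edge_ends[of e]
  by (metis less_le)

lemma ray_neq_interior_edge:
  assumes "e \<in> E" "r \<in> R" "0 < s" "s < 1" "0 \<le> t"
  shows "ray r t \<noteq> edge e s"
  using assms edge_neq_ray[of e r s t] edge_not_vertex[of e s] ray_end[of r]
  by (metis less_le)

lemma path_from_edge:
  assumes "path_of_length x y L" "x = edge e u" "e \<in> E" "0 < u" "u < 1" "L < min u (1 - u)"
  shows "\<exists>t. y = edge e t \<and> 0 < t \<and> t < 1 \<and> \<bar>u - t\<bar> \<le> L"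
  using assms
proof (induction rule: path_of_length.induct)
  case (path_edge x e' s L t)
  have "L < min u (1 - u)" using path_edge.prems by linarith
  then obtain s' where s': "edge e' s = edge e s'" "0 < s'" "s' < 1" "\<bar>u - s'\<bar> \<le> L"
    using path_edge.IH path_edge.prems by blast
  then have eq: "e' = e" "s = s'"
    using edge_eq_interiorD[of e' e s s'] path_edge by auto
  have "\<bar>u - t\<bar> \<le> L + \<bar>s - t\<bar>" using s'(4) eq by linarith
  moreover have "0 < t" "t < 1" using calculation path_edge.prems by auto
  ultimately show ?case using eq by blast
next
  case (path_ray x r s L t)
  have "L < min u (1 - u)" using path_ray.prems by linarith
  then obtain s' where "ray r s = edge e s'" "0 < s'" "s' < 1"
    using path_ray.IH path_ray.prems by blast
  then show ?case using ray_neq_interior_edge[of e r s' s] path_ray by auto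
qed auto

lemma path_from_ray:
  assumes "path_of_length x y L" "x = ray r u" "r \<in> R" "0 < u" "L < u"
  shows "\<exists>t. y = ray r t \<and> 0 < t \<and> \<bar>u - t\<bar> \<le> L"
  using assms
proof (induction rule: path_of_length.induct)
  case (path_ray x r' s L t)
  have "L < u" using path_ray.prems by linarith
  then obtain s' where s': "ray r' s = ray r s'" "0 < s'" "\<bar>u - s'\<bar> \<le> L"
    using path_ray.IH path_ray.prems by blast
  then have eq: "r' = r" "s = s'"
    using ray_eq_interiorD[of r' r s s'] path_ray by auto
  have "\<bar>u - t\<bar> \<le> L + \<bar>s - t\<bar>" using s'(3) eq by linarith
  moreover have "0 < t" using calculation path_ray.prems by auto
  ultimately show ?case using eq by blast
next
  case (path_edge x e s L t)
  have "L < u" using path_edge.prems by linarith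
  then obtain s' where "edge e s = ray r s'" "0 < s'"
    using path_edge.IH path_edge.prems by blast
  then show ?case using edge_neq_interior_ray[of e r s s'] path_edge by auto
qed auto

lemma path_from_vertex:
  assumes "path_of_length x y L" "x \<in> V" "L < 1"
  shows "y = x \<or> y \<notin> V"
proof -
  have "y = x \<or>
      (\<exists>e t. e \<in> E \<and> 0 < t \<and> t < 1 \<and> y = edge e t \<and>
          (edge e 0 = x \<and> t \<le> L \<or> edge e 1 = x \<and> 1 - t \<le> L)) \<or>
      (\<exists>r t. r \<in> R \<and> 0 < t \<and> y = ray r t \<and> ray r 0 = x \<and> t \<le> L)"
    using assms
  proof (induction rule: path_of_length.induct)
    case (path_edge x e s L t)
    have L: "L < 1" "0 \<le> L" using path_edge.prems path_nonneg[OF path_edge.hyps(1)] by linarith+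
    have near: "edge e 0 = x \<and> s \<le> L \<or> edge e 1 = x \<and> 1 - s \<le> L"
    proof -
      from path_edge.IH[OF path_edge.prems(1) L(1)] show ?thesis
      proof (elim disjE exE conjE)
        assume "edge e s = x"
        then have "\<not> (0 < s \<and> s < 1)"
          using edge_not_vertex[of e s] path_edge.hyps(2) path_edge.prems(1) by blast
        then have "s = 0 \<or> s = 1" using path_edge.hyps by linarith
        then show ?thesis using \<open>edge e s = x\<close> L by auto
      next
        fix e' t' assume "e' \<in> E" "0 < t'" "t' < 1" "edge e s = edge e' t'"
        then have eq: "e = e'" "s = t'" using edge_eq_interiorD[of e e' s t'] path_edge by auto
        { assume "edge e' 0 = x" "t' \<le> L" then show ?thesis using eq by simp }
        { assume "edge e' 1 = x" "1 - t' \<le> L" then show ?thesis using eq by simp }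
      next
        fix r' t' assume "r' \<in> R" "0 < t'" "edge e s = ray r' t'"
        then show ?thesis using edge_neq_interior_ray[of e r' s t'] path_edge by auto
      qed
    qed
    show ?case
    proof (cases "t = 0 \<or> t = 1")
      case True
      then show ?thesis
        using near path_edge.prems path_edge.hyps L by auto
    next
      case False
      then have "0 < t" "t < 1" using path_edge by auto
      moreover have "edge e 0 = x \<and> t \<le> L + \<bar>s - t\<bar> \<or> edge e 1 = x \<and> 1 - t \<le> L + \<bar>s - t\<bar>"
        using near by linarith
      ultimately show ?thesis using path_edge.hyps by blast
    qed
  next
    case (path_ray x r s L t)
    have L: "L < 1" "0 \<le> L" using path_ray.prems path_nonneg[OF path_ray.hyps(1)] by linarith+
    have near: "ray r 0 = x \<and> s \<le> L"
    proof -
      consider "ray r s = x"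
        | e' t' where "e' \<in> E" "0 < t'" "t' < 1" "ray r s = edge e' t'"
        | r' t' where "r' \<in> R" "0 < t'" "ray r s = ray r' t'" "ray r' 0 = x" "t' \<le> L"
        using path_ray.IH[OF path_ray.prems(1) L(1)] by blast
      then show ?thesis
      proof cases
        case 1
        then have "s = 0"
          using ray_not_vertex[of r s] path_ray.hyps path_ray.prems(1) by (metis less_le)
        then show ?thesis using 1 L by auto
      next
        case 2
        then show ?thesis using ray_neq_interior_edge[of e' r t' s] path_ray.hyps by auto
      next
        case 3
        then show ?thesis using ray_eq_interiorD[of r r' s t'] path_ray.hyps by auto
      qed
    qed
    show ?case
    proof (cases "t = 0")
      case False
      then have "0 < t" using path_ray by auto
      moreover have "ray r 0 = x" "t \<le> L + \<bar>s - t\<bar>"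
        using near by auto
      ultimately show ?thesis using path_ray.hyps by blast
    qed (use near in auto)
  qed auto
  then show ?thesis using edge_not_vertex ray_not_vertex by blast
qed

lemma path_length_bound_aux:
  assumes "x \<noteq> y" "x \<in> points" "x \<notin> V"
  shows "\<exists>\<delta>>0. \<forall>L. path_of_length x y L \<longrightarrow> \<delta> \<le> L"
  using assms(2)
proof (cases rule: points_cases)
  case (edge e u)
  show ?thesis
  proof (cases "\<exists>t. y = edge e t \<and> 0 < t \<and> t < 1")
    case True
    then obtain t where t: "y = edge e t" "0 < t" "t < 1" by blast
    have "min (min u (1 - u)) \<bar>u - t\<bar> \<le> L" if p: "path_of_length x y L" for L
    proof (rule ccontr)
      assume "\<not> ?thesis"
      then have L: "L < min u (1 - u)" "L < \<bar>u - t\<bar>" by linarith+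
      obtain t' where t': "y = edge e t'" "0 < t'" "t' < 1" "\<bar>u - t'\<bar> \<le> L"
        using path_from_edge[OF p edge(4,1,2,3) L(1)] by blast
      then have "t = t'" using edge_eq_edge[of e e t t'] edge(1) t by simp
      then show False using L(2) t'(4) by linarith
    qed
    moreover have "0 < min (min u (1 - u)) \<bar>u - t\<bar>" using assms(1) t edge by auto
    ultimately show ?thesis by blast
  next
    case False
    have "min u (1 - u) \<le> L" if "path_of_length x y L" for L
      using path_from_edge[OF that edge(4,1,2,3)] False not_le by blast
    moreover have "0 < min u (1 - u)" using edge by auto
    ultimately show ?thesis by blast
  qed
next
  case (ray r u)
  show ?thesis
  proof (cases "\<exists>t. y = ray r t \<and> 0 < t")
    case True
    then obtain t where t: "y = ray r t" "0 < t" by blast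
    have "min u \<bar>u - t\<bar> \<le> L" if p: "path_of_length x y L" for L
    proof (rule ccontr)
      assume "\<not> ?thesis"
      then have L: "L < u" "L < \<bar>u - t\<bar>" by linarith+
      obtain t' where t': "y = ray r t'" "0 < t'" "\<bar>u - t'\<bar> \<le> L"
        using path_from_ray[OF p ray(3,1,2) L(1)] by blast
      then have "t = t'" using ray_eq_ray[of r r t t'] ray(1) t by simp
      then show False using L(2) t'(3) by linarith
    qed
    moreover have "0 < min u \<bar>u - t\<bar>" using assms(1) t ray by auto
    ultimately show ?thesis by blast
  next
    case False
    have "u \<le> L" if "path_of_length x y L" for L
      using path_from_ray[OF that ray(3,1,2)] False not_le by blast
    then show ?thesis using ray by blast
  qed
qed (use assms in auto)

lemma path_length_bound:
  assumes "x \<noteq> y" "x \<in> points" "y \<in> points"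
  shows "\<exists>\<delta>>0. \<forall>L. path_of_length x y L \<longrightarrow> \<delta> \<le> L"
proof -
  consider "x \<notin> V" | "y \<notin> V" | "x \<in> V" "y \<in> V" by blast
  then show ?thesis
  proof cases
    case 2
    then show ?thesis
      using path_length_bound_aux[of y x] assms path_sym by blast
  next
    case 3
    then have "1 \<le> L" if "path_of_length x y L" for L
      using path_from_vertex[OF that] assms(1) by force
    then show ?thesis by (intro exI[of _ 1]) auto
  qed (use path_length_bound_aux assms in blast)
qed

end

context finite_connected_ray_graph
begin

lemma arc_dist_le: "path_of_length x y L \<Longrightarrow> arc_dist x y \<le> L"
  using path_in_points[of x y L] path_nonneg
  by (auto simp: arc_dist_def intro!: cInf_lower bdd_belowI[of _ 0])

lemma arc_dist_greatest:
  assumes "x \<in> points" "y \<in> points" "\<And>L. path_of_length x y L \<Longrightarrow> c \<le> L"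
  shows "c \<le> arc_dist x y"
  using assms path_exists[of x y] by (auto simp: arc_dist_def intro!: cInf_greatest)

lemma arc_dist_metric: "Metric_space points arc_dist"
proof
  show nonneg: "0 \<le> arc_dist x y" for x y
    using arc_dist_greatest[of x y 0] path_nonneg by (cases "x \<in> points \<and> y \<in> points")
      (auto simp: arc_dist_def)
  show "arc_dist x y = arc_dist y x" for x y
  proof -
    have "{L. path_of_length x y L} = {L. path_of_length y x L}" using path_sym by blast
    then show ?thesis by (simp add: arc_dist_def)
  qed
  show "arc_dist x y = 0 \<longleftrightarrow> x = y" if "x \<in> points" "y \<in> points" for x y
  proof
    assume "arc_dist x y = 0"
    show "x = y"
    proof (rule ccontr)
      assume "x \<noteq> y"
      then obtain \<delta> where "\<delta> > 0" "\<forall>L. path_of_length x y L \<longrightarrow> \<delta> \<le> L"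
        using path_length_bound \<open>x \<in> points\<close> \<open>y \<in> points\<close> by blast
      then show False
        using arc_dist_greatest[of x y \<delta>] that \<open>arc_dist x y = 0\<close> by auto
    qed
  next
    assume "x = y"
    then show "arc_dist x y = 0"
      using arc_dist_le[OF path_refl, of x] nonneg[of x y] that by auto
  qed
  show "arc_dist x z \<le> arc_dist x y + arc_dist y z"
    if "x \<in> points" "y \<in> points" "z \<in> points" for x y z
  proof -
    have "arc_dist x z - L \<le> arc_dist y z" if L: "path_of_length x y L" for L
    proof (rule arc_dist_greatest)
      show "arc_dist x z - L \<le> L'" if "path_of_length y z L'" for L'
        using arc_dist_le[OF path_trans[OF that L]] by simp
    qed fact+
    then have "arc_dist x z - arc_dist y z \<le> L" if "path_of_length x y L" for L
      using that by force
    then have "arc_dist x z - arc_dist y z \<le> arc_dist x y"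
      by (intro arc_dist_greatest that)
    then show ?thesis by simp
  qed
qed

lemma topspace_ray_graph_topology: "topspace ray_graph_topology = points"
  unfolding ray_graph_topology_def by (rule Metric_space.topspace_mtopology[OF arc_dist_metric])

end

end

theory Submission
  imports Defs
begin

text \<open>
  Every \<open>A \<in> C\<^sub>n(X)\<close> is joined to the whole graph \<open>X\<close> by letting it swell. Let
  \<open>fatten A t\<close> be the closure of the set of points that a path of length at most \<open>t\<close> joins to \<open>A\<close>,
  and put \<open>F s = fatten A t\<close> with \<open>t = s / (1 - s)\<close> for \<open>s < 1\<close>, and \<open>F 1 = X\<close>. Every point of the set
  before closure is joined, inside that set, to a point of \<open>A\<close>; so fattening never creates a new
  component, and \<open>F\<close> stays in \<open>C\<^sub>n(X)\<close> (\<open>fatten_in_hyperspace_C\<close>).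

  As \<open>F\<close> is increasing, Vietoris continuity reduces to two one-sided conditions
  (\<open>pathin_vietoris_increasing\<close>). If \<open>t > 0\<close>, an open set that meets \<open>fatten A t\<close> already meets
  \<open>fatten A t'\<close> for some \<open>t' < t\<close>: cut off the last bit of a path from \<open>A\<close> (\<open>fatten_lower\<close>). At \<open>s = 1\<close> this says that
  every point is at finite distance from \<open>A\<close>.

  The other condition is delicate because \<open>A\<close> may be unbounded: an open set \<open>U\<close> containing \<open>fatten A t\<close>
  should contain \<open>fatten A t'\<close> for some \<open>t' > t\<close>, but \<open>U\<close> need not contain a uniform neighbourhood of
  \<open>fatten A t\<close>. This is where the bound on the components enters: as there are finitely many, \<open>A\<close> is
  either bounded on a given ray or contains a tail of it (\<open>ray_tail_cases\<close>), so all that fattening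
  adds to \<open>A\<close> up to time \<open>t + 1\<close> lies in a compact set (\<open>fatten_subset_truncation\<close>), and on a
  compact set a Lebesgue number does the rest (\<open>fatten_upper\<close>).
\<close>

section \<open>Vietoris hyperspaces\<close>

text \<open>
  Connected sets covering \<open>A\<close> give an upper bound for the number of components, since each component
  contains every member of the cover that it meets. This spares computing the components of \<open>A\<close>.
\<close>

lemma hyperspace_C_I:
  assumes "closedin X A" "A \<noteq> {}"
    and fin: "finite \<C>" and card: "card \<C> \<le> n" and un: "\<Union>\<C> = A"
    and conn: "\<And>C. C \<in> \<C> \<Longrightarrow> connectedin X C"
  shows "A \<in> hyperspace_C X n"
proof -
  let ?S = "subtopology X A"
  define g where "g C = connected_component_of_set ?S (SOME x. x \<in> C)" for C
  have "connected_components_of ?S \<subseteq> g ` \<C>"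
  proof
    fix D assume D: "D \<in> connected_components_of ?S"
    then obtain x where x: "x \<in> topspace ?S" "D = connected_component_of_set ?S x"
      by (auto simp: connected_components_of_def)
    then have "x \<in> A" by simp
    then obtain C where C: "C \<in> \<C>" "x \<in> C" using un by blast
    have "connectedin ?S C"
      using conn[OF C(1)] C(1) un by (auto simp: connectedin_subtopology)
    then have "C \<subseteq> D"
      using C(2) x(2) by (simp add: connected_component_of_maximal)
    moreover have "(SOME x. x \<in> C) \<in> C" using C(2) by (rule someI)
    ultimately have "connected_component_of ?S x (SOME x. x \<in> C)" using x(2) by auto
    then have "g C = D"
      unfolding g_def x(2) using connected_component_of_equiv[of ?S x] by simp
    then show "D \<in> g ` \<C>" using C(1) by blast
  qed
  then have "finite (connected_components_of ?S)" "card (connected_components_of ?S) \<le> card \<C>"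
    using fin by (auto intro: finite_subset surj_card_le)
  then show ?thesis
    using assms(1,2) card by (simp add: hyperspace_C_def)
qed

text \<open>
  For an increasing family the condition \<open>F s \<subseteq> U\<close> persists when \<open>s\<close> decreases and
  \<open>F s \<inter> U \<noteq> {}\<close> persists when \<open>s\<close> increases, so each needs checking in one direction only.
\<close>

lemma pathin_vietoris_increasing:
  fixes F :: "real \<Rightarrow> 'a set"
  assumes hyp: "\<And>s. s \<in> {0..1} \<Longrightarrow> F s \<in> hyperspace_C X n"
    and mono: "\<And>s t. \<lbrakk>0 \<le> s; s \<le> t; t \<le> 1\<rbrakk> \<Longrightarrow> F s \<subseteq> F t"
    and upper: "\<And>s U. \<lbrakk>0 \<le> s; s < 1; openin X U; F s \<subseteq> U\<rbrakk> \<Longrightarrow> \<exists>t. s < t \<and> t \<le> 1 \<and> F t \<subseteq> U"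
    and lower: "\<And>s U. \<lbrakk>0 < s; s \<le> 1; openin X U; F s \<inter> U \<noteq> {}\<rbrakk>
                  \<Longrightarrow> \<exists>t. 0 \<le> t \<and> t < s \<and> F t \<inter> U \<noteq> {}"
  shows "pathin (vietoris_topology X n) F"
proof -
  let ?I = "top_of_set {0..1::real}"
  have sub: "openin ?I {s \<in> {0..1}. F s \<subseteq> U}" if U: "openin X U" for U
  proof (subst openin_subopen, intro ballI)
    fix s assume s: "s \<in> {s \<in> {0..1}. F s \<subseteq> U}"
    show "\<exists>T. openin ?I T \<and> s \<in> T \<and> T \<subseteq> {s \<in> {0..1}. F s \<subseteq> U}"
    proof (cases "s = 1")
      case True
      then have "{0..1} \<subseteq> {s \<in> {0..1}. F s \<subseteq> U}" using s mono[of _ 1] by fastforce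
      then show ?thesis using s by (intro exI[of _ "{0..1}"]) auto
    next
      case False
      then obtain t where t: "s < t" "t \<le> 1" "F t \<subseteq> U" using upper[of s U] U s by auto
      have "{0..1} \<inter> {..<t} \<subseteq> {s \<in> {0..1}. F s \<subseteq> U}" using mono[of _ t] t by force
      then show ?thesis using s t
        by (intro exI[of _ "{0..1} \<inter> {..<t}"]) (auto intro: openin_open_Int)
    qed
  qed
  have meet: "openin ?I {s \<in> {0..1}. F s \<inter> U \<noteq> {}}" if U: "openin X U" for U
  proof (subst openin_subopen, intro ballI)
    fix s assume s: "s \<in> {s \<in> {0..1}. F s \<inter> U \<noteq> {}}"
    show "\<exists>T. openin ?I T \<and> s \<in> T \<and> T \<subseteq> {s \<in> {0..1}. F s \<inter> U \<noteq> {}}"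
    proof (cases "s = 0")
      case True
      then have "{0..1} \<subseteq> {s \<in> {0..1}. F s \<inter> U \<noteq> {}}" using s mono[of 0] by fastforce
      then show ?thesis using s by (intro exI[of _ "{0..1}"]) auto
    next
      case False
      then obtain t where t: "0 \<le> t" "t < s" "F t \<inter> U \<noteq> {}" using lower[of s U] U s by auto
      have "{0..1} \<inter> {t<..} \<subseteq> {s \<in> {0..1}. F s \<inter> U \<noteq> {}}" using mono[of t] t(1,3)
        by (intro subsetI) (force simp: less_le)
      then show ?thesis using s t
        by (intro exI[of _ "{0..1} \<inter> {t<..}"]) (auto intro: openin_open_Int)
    qed
  qed
  have basic: "openin ?I {s \<in> {0..1}. F s \<in> W}" if W: "is_vietoris_basic X n W" for W
  proof -
    obtain \<U> where \<U>: "finite \<U>" "\<forall>U\<in>\<U>. openin X U" "W = vietoris_basic X n \<U>"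
      using W unfolding is_vietoris_basic_def by blast
    have "{s \<in> {0..1}. F s \<in> W}
        = {s \<in> {0..1}. F s \<subseteq> \<Union>\<U>} \<inter> ({0..1} \<inter> (\<Inter>U\<in>\<U>. {s \<in> {0..1}. F s \<inter> U \<noteq> {}}))"
      using hyp by (auto simp: \<U>(3) vietoris_basic_def)
    moreover have "openin ?I {s \<in> {0..1}. F s \<subseteq> \<Union>\<U>}"
      using \<U>(2) by (intro sub openin_Union) auto
    moreover have "openin ?I ({0..1} \<inter> (\<Inter>U\<in>\<U>. {s \<in> {0..1}. F s \<inter> U \<noteq> {}}))"
    proof (cases "\<U> = {}")
      case False
      have "openin ?I (\<Inter>U\<in>\<U>. {s \<in> {0..1}. F s \<inter> U \<noteq> {}})"
        using \<U> False by (intro openin_INT2 meet) auto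
      then show ?thesis by (intro openin_Int) auto
    qed auto
    ultimately show ?thesis by (simp add: openin_Int)
  qed
  have "openin ?I {s \<in> {0..1}. F s \<in> W}" if "openin (vietoris_topology X n) W" for W
  proof -
    obtain \<W> where \<W>: "\<forall>W'\<in>\<W>. is_vietoris_basic X n W'" "\<Union>\<W> = W"
      using \<open>openin (vietoris_topology X n) W\<close>
      by (auto simp: openin_vietoris_topology union_of_def arbitrary_def)
    have "{s \<in> {0..1}. F s \<in> W} = (\<Union>W'\<in>\<W>. {s \<in> {0..1}. F s \<in> W'})"
      using \<W>(2) by blast
    then show ?thesis using \<W>(1) basic by auto
  qed
  then show ?thesis
    using hyp by (auto simp: pathin_def continuous_map topspace_vietoris_topology)
qed


section \<open>Paths and distances in a ray-graph\<close>

context finite_ray_graph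
begin

text \<open>
  Edges and rays with their parameter intervals, so that path arguments treat both kinds at once.
\<close>

definition chart :: "(real \<Rightarrow> 'a) \<Rightarrow> real set \<Rightarrow> bool" where
  "chart f I \<longleftrightarrow> (\<exists>e\<in>E. f = edge e \<and> I = {0..1}) \<or> (\<exists>r\<in>R. f = ray r \<and> I = {0..})"

lemma chart_in_points: "\<lbrakk>chart f I; t \<in> I\<rbrakk> \<Longrightarrow> f t \<in> points"
  unfolding chart_def using edge_in_points ray_in_points by auto

lemma chart_closed_segment: "\<lbrakk>chart f I; s \<in> I; t \<in> I\<rbrakk> \<Longrightarrow> closed_segment s t \<subseteq> I"
  unfolding chart_def by (auto simp: closed_segment_eq_real_ivl split: if_splits)

lemma path_chart:
  assumes "path_of_length x (f s) L" "chart f I" "s \<in> I" "t \<in> I"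
  shows "path_of_length x (f t) (L + \<bar>s - t\<bar>)"
  using assms path_edge path_ray unfolding chart_def by fastforce

lemma path_chart_induct [consumes 1, case_names refl chart]:
  assumes "path_of_length x y L"
    and "\<And>x. x \<in> points \<Longrightarrow> P x x 0"
    and "\<And>x f I s t L. \<lbrakk>path_of_length x (f s) L; P x (f s) L; chart f I; s \<in> I; t \<in> I\<rbrakk>
           \<Longrightarrow> P x (f t) (L + \<bar>s - t\<bar>)"
  shows "P x y L"
  using assms(1)
proof (induction rule: path_of_length.induct)
  case (path_edge x e s L t)
  then show ?case by (intro assms(3)[where I = "{0..1}"]) (auto simp: chart_def)
next
  case (path_ray x r s L t)
  then show ?case by (intro assms(3)[where I = "{0..}"]) (auto simp: chart_def)
qed (rule assms(2))

lemma path_split: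
  assumes "path_of_length x y L" "0 \<le> \<eta>" "\<eta> \<le> L"
  shows "\<exists>z. path_of_length x z (L - \<eta>) \<and> path_of_length z y \<eta>"
  using assms
proof (induction arbitrary: \<eta> rule: path_chart_induct)
  case (refl x)
  then show ?case using path_refl by auto
next
  case (chart x f I s t L)
  show ?case
  proof (cases "\<eta> \<le> \<bar>s - t\<bar>")
    case True
    \<comment> \<open>The cut lies on the last segment, at parameter distance \<open>\<eta>\<close> before its end.\<close>
    define v where "v = (if s \<le> t then t - \<eta> else t + \<eta>)"
    have v: "v \<in> closed_segment s t" "\<bar>v - t\<bar> = \<eta>" "\<bar>s - v\<bar> = \<bar>s - t\<bar> - \<eta>"
      using True chart.prems by (auto simp: v_def closed_segment_eq_real_ivl)
    then have vI: "v \<in> I" using chart_closed_segment chart.hyps by blast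
    have "path_of_length x (f v) (L + \<bar>s - v\<bar>)"
      using chart.hyps vI by (intro path_chart)
    moreover have "path_of_length (f v) (f t) (0 + \<bar>v - t\<bar>)"
      using chart.hyps vI by (intro path_chart path_refl chart_in_points)
    ultimately show ?thesis using v by (auto simp: algebra_simps)
  next
    case False
    then obtain z where z: "path_of_length x z (L - (\<eta> - \<bar>s - t\<bar>))"
      "path_of_length z (f s) (\<eta> - \<bar>s - t\<bar>)"
      using chart.IH[of "\<eta> - \<bar>s - t\<bar>"] chart.prems by auto
    have "path_of_length z (f t) (\<eta> - \<bar>s - t\<bar> + \<bar>s - t\<bar>)"
      using z(2) chart.hyps by (intro path_chart)
    then show ?thesis using z(1) by (auto simp: algebra_simps)
  qed
qed

text \<open>
  The retraction of the graph onto the ray \<open>r\<close>, read as a real number: everything off the open ray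
  is sent to its endpoint. It never increases distances, so it turns questions about connected or
  nearby sets on a ray into questions about the real line.
\<close>

definition height :: "'r \<Rightarrow> 'a \<Rightarrow> real" where
  "height r y = (if y \<in> ray r ` {0<..} then the_inv_into {0<..} (ray r) y else 0)"

lemma inj_on_ray: "r \<in> R \<Longrightarrow> inj_on (ray r) {0<..}"
  by (auto simp: inj_on_def dest: ray_eq_ray)

lemma height_ray:
  assumes "r \<in> R" "r' \<in> R" "0 \<le> t"
  shows "height r (ray r' t) = (if r' = r then t else 0)"
proof (cases "r' = r \<and> 0 < t")
  case True
  then show ?thesis
    using assms by (auto simp: height_def inj_on_ray the_inv_into_f_f)
next
  case False
  then have "ray r' t \<notin> ray r ` {0<..}"
    using ray_eq_interiorD[OF assms(2,1,3)] by force
  then show ?thesis using False assms by (auto simp: height_def)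
qed

lemma height_edge:
  assumes "r \<in> R" "e \<in> E" "0 \<le> t" "t \<le> 1"
  shows "height r (edge e t) = 0"
  using assms edge_neq_interior_ray[of e r t] by (auto simp: height_def)

lemma ray_height: "r \<in> R \<Longrightarrow> 0 < height r y \<Longrightarrow> ray r (height r y) = y"
  by (auto simp: height_def inj_on_ray the_inv_into_f_f split: if_splits)

lemma path_height:
  assumes "path_of_length x y L" "r \<in> R"
  shows "\<bar>height r x - height r y\<bar> \<le> L"
  using assms
proof (induction rule: path_of_length.induct)
  case (path_edge x e s L t)
  then have "\<bar>height r x - height r (edge e s)\<bar> \<le> L" by blast
  then show ?case using path_edge.hyps path_edge.prems by (simp add: height_edge)
next
  case (path_ray x r' s L t)
  then have "\<bar>height r x - height r (ray r' s)\<bar> \<le> L" by blast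
  then show ?case
    using path_ray.hyps path_ray.prems by (simp add: height_ray split: if_splits)
qed simp

definition reach :: "'a set \<Rightarrow> real \<Rightarrow> 'a set" where
  "reach A t = {y. \<exists>x\<in>A. \<exists>L\<le>t. path_of_length x y L}"

lemma reachI: "\<lbrakk>x \<in> A; path_of_length x y L; L \<le> t\<rbrakk> \<Longrightarrow> y \<in> reach A t"
  unfolding reach_def by blast

lemma reachE:
  assumes "y \<in> reach A t"
  obtains x L where "x \<in> A" "path_of_length x y L" "L \<le> t"
  using assms unfolding reach_def by blast

lemma reach_mono: "t \<le> t' \<Longrightarrow> reach A t \<subseteq> reach A t'"
  by (meson order_trans reachI reachE subsetI)

lemma reach_subset_points: "reach A t \<subseteq> points"
  using path_in_points by (auto simp: reach_def)

lemma subset_reach: "A \<subseteq> points \<Longrightarrow> 0 \<le> t \<Longrightarrow> A \<subseteq> reach A t"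
  using path_refl by (force simp: reach_def)

text \<open>
  The closure makes the sets closed without having to know that shortest paths exist.
\<close>

definition fatten :: "'a set \<Rightarrow> real \<Rightarrow> 'a set" where
  "fatten A t = ray_graph_topology closure_of reach A t"

definition truncation :: "real \<Rightarrow> 'a set" where
  "truncation M = V \<union> (\<Union>e\<in>E. edge e ` {0..1}) \<union> (\<Union>r\<in>R. ray r ` {0..M})"

lemma points_minus_truncation:
  assumes "y \<in> points" "y \<notin> truncation M"
  obtains r where "r \<in> R" "M < height r y"
proof -
  obtain r t where rt: "r \<in> R" "0 \<le> t" "y = ray r t"
    using assms by (auto simp: points_def truncation_def)
  moreover have "\<not> t \<le> M" using assms(2) rt by (auto simp: truncation_def)
  ultimately show thesis using that[of r] by (simp add: height_ray)
qed

end


context finite_connected_ray_graph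
begin

sublocale arc: Metric_space points arc_dist
  by (rule arc_dist_metric)

lemma ray_graph_topology_eq: "ray_graph_topology = arc.mtopology"
  by (simp add: ray_graph_topology_def)

lemma hyperspace_C_subset_points: "A \<in> hyperspace_C ray_graph_topology n \<Longrightarrow> A \<subseteq> points"
  using closedin_subset by (fastforce simp: hyperspace_C_def simp flip: topspace_ray_graph_topology)

lemma continuous_map_chart:
  assumes "chart f I"
  shows "continuous_map (top_of_set I) ray_graph_topology f"
proof -
  have *: "arc_dist (f s) (f t) \<le> \<bar>s - t\<bar>" if "s \<in> I" "t \<in> I" for s t
    using arc_dist_le[OF path_chart[OF path_refl assms, of s t]] assms that
    by (auto simp: chart_in_points)
  show ?thesis
    unfolding ray_graph_topology_eq arc.continuous_map_to_metric
  proof (intro ballI allI impI)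
    fix s \<epsilon> :: real assume s: "s \<in> topspace (top_of_set I)" and "0 < \<epsilon>"
    then have "f t \<in> arc.mball (f s) \<epsilon>" if "t \<in> I \<inter> ball s \<epsilon>" for t
      using *[of s t] that assms by (auto simp: chart_in_points dist_real_def)
    then show "\<exists>U. openin (top_of_set I) U \<and> s \<in> U \<and> (\<forall>t\<in>U. f t \<in> arc.mball (f s) \<epsilon>)"
      using s \<open>0 < \<epsilon>\<close> by (intro exI[of _ "I \<inter> ball s \<epsilon>"]) (auto intro: openin_open_Int)
  qed
qed

lemma continuous_map_height:
  assumes "r \<in> R"
  shows "continuous_map ray_graph_topology euclidean (height r)"
proof -
  have *: "\<bar>height r x - height r y\<bar> \<le> arc_dist x y" if "x \<in> points" "y \<in> points" for x y
    using that path_height[OF _ assms] by (intro arc_dist_greatest)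
  have "continuous_map arc.mtopology (Met_TC.mtopology) (height r)"
    unfolding arc.metric_continuous_map[OF Met_TC.Metric_space_axioms]
    using * by (fastforce simp: dist_real_def)
  then show ?thesis by (simp add: ray_graph_topology_eq)
qed

lemma compactin_truncation: "compactin ray_graph_topology (truncation M)"
proof -
  have "compactin ray_graph_topology V"
    using finite_V by (intro finite_imp_compactin) (auto simp: topspace_ray_graph_topology points_def)
  moreover have "compactin ray_graph_topology (\<Union>e\<in>E. edge e ` {0..1})"
    using finite_E continuous_map_chart[of "edge _" "{0..1}"]
    by (intro compactin_Union) (auto intro!: image_compactin simp: compactin_subtopology chart_def)
  moreover have "compactin ray_graph_topology (\<Union>r\<in>R. ray r ` {0..M})"
    using finite_R continuous_map_chart[of "ray _" "{0..}"]
    by (intro compactin_Union) (auto intro!: image_compactin simp: compactin_subtopology chart_def)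
  ultimately show ?thesis unfolding truncation_def by (intro compactin_Un)
qed

lemma path_connected_set:
  assumes "path_of_length x y L"
  shows "\<exists>S. connectedin ray_graph_topology S \<and> x \<in> S \<and> y \<in> S \<and> S \<subseteq> reach {x} L"
  using assms
proof (induction rule: path_chart_induct)
  case (refl x)
  then show ?case using subset_reach[of "{x}" 0]
    by (intro exI[of _ "{x}"]) (auto simp: topspace_ray_graph_topology)
next
  case (chart x f I s t L)
  then obtain S where S: "connectedin ray_graph_topology S" "x \<in> S" "f s \<in> S" "S \<subseteq> reach {x} L"
    by blast
  let ?T = "f ` closed_segment s t"
  have sub: "closed_segment s t \<subseteq> I"
    using chart.hyps by (intro chart_closed_segment)
  have "connectedin ray_graph_topology ?T"
    using chart.hyps sub by (intro connectedin_continuous_map_image[OF continuous_map_chart])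
      (auto simp: connectedin_subtopology)
  then have "connectedin ray_graph_topology (S \<union> ?T)"
    using S by (intro connectedin_Un) auto
  moreover have "?T \<subseteq> reach {x} (L + \<bar>s - t\<bar>)"
  proof (clarify)
    fix v assume v: "v \<in> closed_segment s t"
    then have "path_of_length x (f v) (L + \<bar>s - v\<bar>)"
      using chart.hyps sub v by (intro path_chart[where I = I]) auto
    moreover have "\<bar>s - v\<bar> \<le> \<bar>s - t\<bar>"
      using v by (auto simp: closed_segment_eq_real_ivl split: if_splits)
    ultimately show "f v \<in> reach {x} (L + \<bar>s - t\<bar>)"
      by (intro reachI[of x]) auto
  qed
  ultimately show ?case
    using S reach_mono[of L "L + \<bar>s - t\<bar>" "{x}"] by (intro exI[of _ "S \<union> ?T"]) auto
qed

lemma connected_space_ray_graph: "connected_space ray_graph_topology"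
  unfolding connected_space_subconnected topspace_ray_graph_topology
  using path_exists path_connected_set by meson


section \<open>Fattening a closed set\<close>

lemma fatten_mono: "t \<le> t' \<Longrightarrow> fatten A t \<subseteq> fatten A t'"
  unfolding fatten_def by (intro closure_of_mono reach_mono)

lemma reach_subset_fatten: "reach A t \<subseteq> fatten A t"
  unfolding fatten_def
  by (intro closure_of_subset) (simp add: topspace_ray_graph_topology reach_subset_points)

lemma fatten_0:
  assumes "closedin ray_graph_topology A"
  shows "fatten A 0 = A"
proof -
  have A: "A \<subseteq> points" using closedin_subset[OF assms] by (simp add: topspace_ray_graph_topology)
  have "reach A 0 \<subseteq> A"
  proof
    fix y assume "y \<in> reach A 0"
    then obtain x L where x: "x \<in> A" "path_of_length x y L" "L \<le> 0" by (auto simp: reach_def)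
    then have "arc_dist x y = 0" using arc_dist_le[of x y L] arc.nonneg[of x y] by linarith
    then have "x = y" using path_in_points[OF x(2)] arc.zero by blast
    then show "y \<in> A" using x(1) by simp
  qed
  then have "reach A 0 = A" using subset_reach[OF A] by auto
  then show ?thesis using assms by (simp add: fatten_def closure_of_closedin)
qed

text \<open>
  The set is a union of connected sets, each consisting of \<open>C\<close> and a path issuing from \<open>C\<close>.
\<close>

lemma connectedin_reach:
  assumes "connectedin ray_graph_topology C" "0 \<le> t"
  shows "connectedin ray_graph_topology (reach C t)"
proof (cases "C = {}")
  case True
  then show ?thesis by (simp add: reach_def)
next
  case False
  have C: "C \<subseteq> points"
    using connectedin_subset_topspace[OF assms(1)] by (simp add: topspace_ray_graph_topology)
  define \<S> where "\<S> = {C \<union> S |S. connectedin ray_graph_topology S \<and> C \<inter> S \<noteq> {} \<and> S \<subseteq> reach C t}"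
  have "\<exists>T\<in>\<S>. y \<in> T" if y: "y \<in> reach C t" for y
  proof -
    obtain x L where x: "x \<in> C" "path_of_length x y L" "L \<le> t"
      using y by (rule reachE)
    obtain S where S: "connectedin ray_graph_topology S" "x \<in> S" "y \<in> S" "S \<subseteq> reach {x} L"
      using path_connected_set[OF x(2)] by blast
    have "S \<subseteq> reach C t" using S(4) x by (force elim: reachE intro: reachI)
    then have "C \<union> S \<in> \<S>" unfolding \<S>_def using S x(1) by blast
    then show ?thesis using S(3) by blast
  qed
  then have "reach C t = \<Union>\<S>"
    using subset_reach[OF C assms(2)] by (auto simp: \<S>_def)
  moreover have "connectedin ray_graph_topology (\<Union>\<S>)"
  proof (rule connectedin_Union)
    show "connectedin ray_graph_topology T" if "T \<in> \<S>" for T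
      using that assms(1) by (auto simp: \<S>_def intro: connectedin_Un)
    show "\<Inter>\<S> \<noteq> {}" using False by (auto simp: \<S>_def)
  qed
  ultimately show ?thesis by simp
qed

text \<open>
  Fattening commutes with the finite union of the components of \<open>A\<close>, and turns each of them into a
  connected set.
\<close>

lemma fatten_in_hyperspace_C:
  assumes A: "A \<in> hyperspace_C ray_graph_topology n" and "0 \<le> t"
  shows "fatten A t \<in> hyperspace_C ray_graph_topology n"
proof (rule hyperspace_C_I)
  let ?X = ray_graph_topology
  let ?D = "connected_components_of (subtopology ?X A)"
  have Apts: "A \<subseteq> points"
    using A by (rule hyperspace_C_subset_points)
  have D: "\<Union>?D = A"
    using Apts by (simp add: Union_connected_components_of topspace_ray_graph_topology Int_absorb1)
  have finD: "finite ?D" using A by (simp add: hyperspace_C_def)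
  show "closedin ?X (fatten A t)" by (simp add: fatten_def)
  show "fatten A t \<noteq> {}"
    using A subset_reach[OF Apts assms(2)] reach_subset_fatten[of A t] by (auto simp: hyperspace_C_def)
  show "finite ((\<lambda>C. fatten C t) ` ?D)" using finD by simp
  show "card ((\<lambda>C. fatten C t) ` ?D) \<le> n"
    using A card_image_le[OF finD, of "\<lambda>C. fatten C t"] by (simp add: hyperspace_C_def)
  have "reach A t = (\<Union>C\<in>?D. reach C t)" using D unfolding reach_def by blast
  then show "\<Union>((\<lambda>C. fatten C t) ` ?D) = fatten A t"
    using finD by (simp add: fatten_def closure_of_Union image_image)
  show "connectedin ?X C'" if "C' \<in> (\<lambda>C. fatten C t) ` ?D" for C'
    using that connectedin_connected_components_of[of _ "subtopology ?X A"] assms(2)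
    by (auto simp: fatten_def connectedin_subtopology intro!: connectedin_closure_of connectedin_reach)
qed

lemma points_in_hyperspace_C:
  assumes "points \<noteq> {}" "n \<ge> 1"
  shows "points \<in> hyperspace_C ray_graph_topology n"
  using assms connected_space_ray_graph
  by (intro hyperspace_C_I[where \<C> = "{points}"])
    (auto simp flip: topspace_ray_graph_topology simp: connectedin_topspace)

text \<open>
  A path of length at most \<open>t + \<delta>\<close> starting in \<open>A\<close> can be cut at length \<open>t\<close>, leaving a rest of length
  at most \<open>\<delta>\<close>. The margin \<open>\<epsilon>\<close> pays for the closure.
\<close>

lemma fatten_add_near:
  assumes "y \<in> fatten A (t + \<delta>)" "0 \<le> t" "0 \<le> \<delta>" "0 < \<epsilon>"
  shows "\<exists>z\<in>reach A t. arc_dist y z < \<delta> + \<epsilon>"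
proof -
  obtain y' where y': "y' \<in> reach A (t + \<delta>)" "y' \<in> arc.mball y \<epsilon>"
    using assms(1,4) by (auto simp: fatten_def ray_graph_topology_eq arc.metric_closure_of)
  obtain x L where x: "x \<in> A" "path_of_length x y' L" "L \<le> t + \<delta>"
    using y'(1) by (auto simp: reach_def)
  have "\<exists>z\<in>reach A t. arc_dist z y' \<le> \<delta>"
  proof (cases "L \<le> t")
    case True
    then have "y' \<in> reach A t" using x by (auto simp: reach_def)
    then show ?thesis using y'(2) assms(3) by (intro bexI[of _ y']) auto
  next
    case False
    then obtain z where z: "path_of_length x z (L - (L - t))" "path_of_length z y' (L - t)"
      using path_split[OF x(2), of "L - t"] assms(2) by auto
    then have "z \<in> reach A t" using x(1) by (force simp: reach_def)
    then show ?thesis using arc_dist_le[OF z(2)] x(3) by force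
  qed
  then obtain z where z: "z \<in> reach A t" "arc_dist z y' \<le> \<delta>" by blast
  have "arc_dist y z \<le> arc_dist y y' + arc_dist y' z"
    using y'(2) z(1) reach_subset_points by (intro arc.triangle) auto
  then show ?thesis using y'(2) z arc.commute[of z y'] by (intro bexI[of _ z]) auto
qed

text \<open>
  An open set that meets the closure contains the end of a path of length at most \<open>t\<close> from \<open>A\<close>,
  together with a final piece of that path.
\<close>

lemma fatten_lower:
  assumes "openin ray_graph_topology U" "fatten A t \<inter> U \<noteq> {}" "0 < t"
  shows "\<exists>t'. 0 \<le> t' \<and> t' < t \<and> fatten A t' \<inter> U \<noteq> {}"
proof -
  have "U \<inter> reach A t \<noteq> {}"
    using assms(2) openin_Int_closure_of_eq_empty[OF assms(1), of "reach A t"]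
    by (auto simp: fatten_def)
  then obtain x y L where y: "y \<in> U" "x \<in> A" "path_of_length x y L" "L \<le> t"
    by (auto simp: reach_def)
  obtain \<rho> where \<rho>: "0 < \<rho>" "arc.mball y \<rho> \<subseteq> U"
    using assms(1) y(1) by (auto simp: ray_graph_topology_eq arc.openin_mtopology)
  define \<eta> where "\<eta> = min L (\<rho> / 2)"
  have L: "0 \<le> L" using path_nonneg[OF y(3)] .
  then obtain z where z: "path_of_length x z (L - \<eta>)" "path_of_length z y \<eta>"
    using path_split[OF y(3), of \<eta>] \<rho>(1) by (auto simp: \<eta>_def)
  have "arc_dist y z \<le> \<eta>" using arc_dist_le[OF path_sym[OF z(2)]] .
  then have "arc_dist y z < \<rho>" using \<rho>(1) by (auto simp: \<eta>_def)
  then have "z \<in> U" using \<rho>(2) path_in_points[OF z(2)] by auto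
  moreover have "z \<in> fatten A (L - \<eta>)"
    using z(1) y(2) reach_subset_fatten by (fastforce simp: reach_def)
  moreover have "0 \<le> L - \<eta>" "L - \<eta> < t"
    using L y(4) assms(3) \<rho>(1) by (auto simp: \<eta>_def min_def)
  ultimately show ?thesis by blast
qed

text \<open>
  If \<open>A\<close> is unbounded on the ray, then so is one of its finitely many components, and the heights
  occurring in this component form an unbounded interval.
\<close>

lemma ray_tail_cases:
  assumes A: "A \<in> hyperspace_C ray_graph_topology n" and r: "r \<in> R"
  shows "\<exists>M. (\<forall>u>M. ray r u \<in> A) \<or> (\<forall>y\<in>A. height r y \<le> M)"
proof (cases "bdd_above (height r ` A)")
  case True
  then show ?thesis by (auto simp: bdd_above_def)
next
  case False
  let ?X = ray_graph_topology
  let ?D = "connected_components_of (subtopology ?X A)"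
  have Apts: "A \<subseteq> points"
    using A by (rule hyperspace_C_subset_points)
  have D: "\<Union>?D = A"
    using Apts by (simp add: Union_connected_components_of topspace_ray_graph_topology Int_absorb1)
  have finD: "finite ?D" using A by (simp add: hyperspace_C_def)
  have "height r ` A = (\<Union>C\<in>?D. height r ` C)" using D by blast
  then obtain C where C: "C \<in> ?D" "\<not> bdd_above (height r ` C)"
    using False bdd_above_UN[OF finD, of "\<lambda>C. height r ` C"] by metis
  have "connectedin ?X C"
    using connectedin_connected_components_of[OF C(1)] by (simp add: connectedin_subtopology)
  then have conn: "connected (height r ` C)"
    using connectedin_continuous_map_image[OF continuous_map_height[OF r]] by simp
  obtain c where c: "c \<in> height r ` C" using C(2) by fastforce
  have "ray r u \<in> A" if u: "u > max 0 c" for u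
  proof -
    obtain v where v: "v \<in> height r ` C" "u < v"
      using C(2) unfolding bdd_above_def by (meson not_le)
    then have "u \<in> height r ` C" using connectedD_interval[OF conn c v(1)] u by auto
    then obtain y where "y \<in> C" "height r y = u" by blast
    then have "ray r u \<in> C" using ray_height[OF r, of y] u by auto
    then show ?thesis using C(1) D by blast
  qed
  then show ?thesis by blast
qed

text \<open>
  Far out on a ray, a point is either in \<open>A\<close> because \<open>A\<close> contains the tail, or farther than \<open>t\<close>
  from \<open>A\<close> because \<open>A\<close> is bounded on the ray and a path changes the height by at most its length.
\<close>

lemma fatten_subset_truncation:
  assumes A: "A \<in> hyperspace_C ray_graph_topology n"
  shows "\<exists>M. fatten A t \<subseteq> A \<union> truncation M"
proof -
  obtain m where m: "\<And>r. r \<in> R \<Longrightarrow> (\<forall>u>m r. ray r u \<in> A) \<or> (\<forall>y\<in>A. height r y \<le> m r)"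
    using ray_tail_cases[OF A] by metis
  obtain M where M: "\<And>r. r \<in> R \<Longrightarrow> m r \<le> M"
    using Max_ge[of "m ` R"] finite_R by blast
  have "reach A t \<subseteq> A \<union> truncation (max 0 (M + \<bar>t\<bar>))"
  proof
    fix y assume y: "y \<in> reach A t"
    show "y \<in> A \<union> truncation (max 0 (M + \<bar>t\<bar>))"
    proof (rule ccontr)
      assume "\<not> ?thesis"
      then have "y \<notin> A" "y \<notin> truncation (max 0 (M + \<bar>t\<bar>))" by auto
      moreover have "y \<in> points" using y reach_subset_points by blast
      ultimately obtain r where r: "r \<in> R" "max 0 (M + \<bar>t\<bar>) < height r y"
        using points_minus_truncation by blast
      obtain x L where x: "x \<in> A" "path_of_length x y L" "L \<le> t"
        using y by (auto simp: reach_def)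
      have "m r < height r y" using r M[OF r(1)] by auto
      moreover have "m r < height r x" using path_height[OF x(2) r(1)] r M[OF r(1)] x(3) by auto
      moreover have "ray r (height r y) = y" using ray_height[OF r(1), of y] r(2) by auto
      ultimately show False using m[OF r(1)] x(1) \<open>y \<notin> A\<close> by force
    qed
  qed
  moreover have "closedin ray_graph_topology (A \<union> truncation (max 0 (M + \<bar>t\<bar>)))"
    using A compactin_imp_closedin[OF _ compactin_truncation] arc.Hausdorff_space_mtopology
    by (intro closedin_Un) (auto simp: hyperspace_C_def ray_graph_topology_eq)
  ultimately show ?thesis unfolding fatten_def using closure_of_minimal by blast
qed

text \<open>
  Points of \<open>fatten A (t + 1)\<close> outside \<open>U\<close> lie in a compact set disjoint from the closed set
  \<open>fatten A t\<close>, hence at distance at least some \<open>\<epsilon> > 0\<close> from it; fattening by less than \<open>\<epsilon>\<close> cannot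
  reach them.
\<close>

lemma fatten_upper:
  assumes A: "A \<in> hyperspace_C ray_graph_topology n"
    and U: "openin ray_graph_topology U" and sub: "fatten A t \<subseteq> U" and t: "0 \<le> t"
  shows "\<exists>t'>t. fatten A t' \<subseteq> U"
proof -
  let ?X = ray_graph_topology
  have "A \<subseteq> points"
    using A by (rule hyperspace_C_subset_points)
  then have "A \<subseteq> U" using subset_reach[of A t] reach_subset_fatten[of A t] t sub by blast
  obtain M where M: "fatten A (t + 1) \<subseteq> A \<union> truncation M"
    using fatten_subset_truncation[OF A] by blast
  define Q where "Q = truncation M \<inter> (points - U)"
  have "compactin ?X Q" unfolding Q_def
    using U by (intro compact_Int_closedin compactin_truncation)
      (simp add: openin_closedin_eq flip: topspace_ray_graph_topology)
  moreover have "openin ?X (points - fatten A t)"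
    unfolding topspace_ray_graph_topology[symmetric] fatten_def
    by (intro openin_diff openin_topspace closedin_closure_of)
  moreover have "Q \<subseteq> \<Union>{points - fatten A t}" using sub by (auto simp: Q_def)
  ultimately obtain \<epsilon> where \<epsilon>: "0 < \<epsilon>" "\<And>q. q \<in> Q \<Longrightarrow> arc.mball q \<epsilon> \<subseteq> points - fatten A t"
    using arc.lebesgue_number[of Q "{points - fatten A t}"]
    by (auto simp: ray_graph_topology_eq)
  define \<delta> where "\<delta> = min 1 (\<epsilon> / 2)"
  have "fatten A (t + \<delta>) \<subseteq> U"
  proof (rule ccontr)
    assume "\<not> ?thesis"
    then obtain y where y: "y \<in> fatten A (t + \<delta>)" "y \<notin> U" by blast
    have "y \<in> fatten A (t + 1)" using y(1) fatten_mono[of "t + \<delta>" "t + 1" A] by (auto simp: \<delta>_def)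
    moreover have "y \<in> points"
      using y(1) closure_of_subset_topspace[of ?X] by (auto simp: fatten_def topspace_ray_graph_topology)
    ultimately have "y \<in> Q" using M y(2) \<open>A \<subseteq> U\<close> by (auto simp: Q_def)
    obtain z where z: "z \<in> reach A t" "arc_dist y z < \<delta> + \<epsilon> / 2"
      using fatten_add_near[OF y(1) t, of "\<epsilon> / 2"] \<epsilon>(1) by (auto simp: \<delta>_def)
    have "z \<in> arc.mball y \<epsilon>"
      using z \<open>y \<in> points\<close> reach_subset_points[of A t] by (auto simp: \<delta>_def)
    then show False using \<epsilon>(2)[OF \<open>y \<in> Q\<close>] z(1) reach_subset_fatten by blast
  qed
  moreover have "t < t + \<delta>" using \<epsilon>(1) by (simp add: \<delta>_def)
  ultimately show ?thesis by blast
qed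

section \<open>The path from a closed set to the whole graph\<close>

lemma path_component_of_points:
  assumes A: "A \<in> hyperspace_C ray_graph_topology n" and n: "n \<ge> 1"
  shows "path_component_of (vietoris_topology ray_graph_topology n) A points"
proof -
  let ?X = ray_graph_topology
  have cl: "closedin ?X A" "A \<noteq> {}" using A by (auto simp: hyperspace_C_def)
  have Apts: "A \<subseteq> points"
    using A by (rule hyperspace_C_subset_points)
  \<comment> \<open>\<open>s \<mapsto> s / (1 - s)\<close> maps \<open>[0,1)\<close> onto \<open>[0,\<infinity>)\<close>, with inverse \<open>t \<mapsto> t / (1 + t)\<close>.\<close>
  define F where "F s = (if s < 1 then fatten A (s / (1 - s)) else points)" for s :: real
  have inv: "t / (1 + t) < 1" "t / (1 + t) / (1 - t / (1 + t)) = t" if "0 \<le> t" for t :: real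
    using that by (auto simp: field_simps)
  have F_inv: "F (t / (1 + t)) = fatten A t" if "0 \<le> t" for t
    using inv[OF that] by (simp add: F_def)
  have fatten_points: "fatten A t \<subseteq> points" for t
    using closure_of_subset_topspace[of ?X] by (auto simp: fatten_def topspace_ray_graph_topology)
  have "pathin (vietoris_topology ?X n) F"
  proof (rule pathin_vietoris_increasing)
    show "F s \<in> hyperspace_C ?X n" if "s \<in> {0..1}" for s
      using that fatten_in_hyperspace_C[OF A] points_in_hyperspace_C[OF _ n] cl(2) Apts
      by (auto simp: F_def)
    show "F s \<subseteq> F t" if "0 \<le> s" "s \<le> t" "t \<le> 1" for s t
    proof (cases "t < 1")
      case True
      then have "s / (1 - s) \<le> t / (1 - t)" using that by (intro frac_le) auto
      then show ?thesis using True that fatten_mono by (simp add: F_def)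
    qed (use fatten_points in \<open>simp add: F_def\<close>)
  next
    fix s U assume s: "0 \<le> s" "s < 1" and U: "openin ?X U" "F s \<subseteq> U"
    have "0 \<le> s / (1 - s)" using s by simp
    then obtain t where t: "s / (1 - s) < t" "fatten A t \<subseteq> U"
      using fatten_upper[OF A U(1), of "s / (1 - s)"] U(2) s by (auto simp: F_def)
    then have t0: "0 \<le> t" using \<open>0 \<le> s / (1 - s)\<close> by linarith
    have "s < t / (1 + t)" using t(1) s t0 by (simp add: field_simps)
    then show "\<exists>t. s < t \<and> t \<le> 1 \<and> F t \<subseteq> U"
      using t(2) F_inv[OF t0] inv(1)[OF t0] by (intro exI[of _ "t / (1 + t)"]) auto
  next
    fix s U assume s: "0 < s" "s \<le> 1" and U: "openin ?X U" "F s \<inter> U \<noteq> {}"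
    have "\<exists>t\<ge>0. t / (1 + t) < s \<and> fatten A t \<inter> U \<noteq> {}"
    proof (cases "s < 1")
      case True
      then obtain t where t: "0 \<le> t" "t < s / (1 - s)" "fatten A t \<inter> U \<noteq> {}"
        using fatten_lower[OF U(1), of A "s / (1 - s)"] U(2) s by (auto simp: F_def)
      have "t / (1 + t) < s" using t True by (simp add: field_simps)
      then show ?thesis using t by blast
    next
      case False
      then obtain y where y: "y \<in> points" "y \<in> U" using U(2) by (auto simp: F_def)
      obtain x where x: "x \<in> A" using cl(2) by blast
      then obtain L where L: "path_of_length x y L" using path_exists y(1) Apts by blast
      then have "y \<in> fatten A L" using reach_subset_fatten[of A L] x by (auto simp: reach_def)
      then show ?thesis
        using y(2) path_nonneg[OF L] inv(1)[of L] s False by (intro exI[of _ L]) auto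
    qed
    then obtain t where t: "0 \<le> t" "t / (1 + t) < s" "fatten A t \<inter> U \<noteq> {}" by blast
    then show "\<exists>t. 0 \<le> t \<and> t < s \<and> F t \<inter> U \<noteq> {}"
      using F_inv[OF t(1)] by (intro exI[of _ "t / (1 + t)"]) auto
  qed
  moreover have "F 0 = A" "F 1 = points" using fatten_0[OF cl(1)] by (auto simp: F_def)
  ultimately show ?thesis unfolding path_component_of_def by blast
qed

end

theorem theorem6p2:
  fixes V :: "'a set" and E :: "'e set" and edge :: "'e \<Rightarrow> real \<Rightarrow> 'a"
    and R :: "'r set" and ray :: "'r \<Rightarrow> real \<Rightarrow> 'a" and n :: nat
  assumes "finite_connected_ray_graph V E edge R ray"
    and "n \<ge> 1"
  shows "path_connected_space
           (vietoris_topology (finite_ray_graph.ray_graph_topology V E edge R ray) n)"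
proof -
  interpret finite_connected_ray_graph V E edge R ray by fact
  show ?thesis
    unfolding path_connected_space_iff_path_component topspace_vietoris_topology
    using path_component_of_points[OF _ assms(2)]
    by (blast intro: path_component_of_sym path_component_of_trans)
qed

end
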